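(* Let $\mathbb H=\{z\in\mathbb C:\operatorname{Im} z>0\}$ with its standard complex structure $j$ and the action of $G=\mathrm{PSL}(2,\mathbb R)$ by Möbius transformations. There is a unique integrable $G$-invariant complexion on the reduced frame bundle of $\mathbb H$.
   Context: The reduced frame bundle $P$ of $\mathbb H$ is the principal $\mathrm{GL}(1,\mathbb C)=\mathbb C^*$-bundle $\pi:P\to\mathbb H$ whose fibre over $x$ consists of the complex-linear isomorphisms $\mathbb C\to(T_x\mathbb H,j_x)$, with $\mathbb C^*$ acting on the right by precomposition; $G$ acts on $P$ on the left by $g\cdot p=L_{g*}\circ p$, where $L_g$ is the action of $g$ on $\mathbb H$. Let $H=\mathbb C^*$ with its canonical complex structure $i_H$. A complexion on $P$ is an almost complex structure $J$ on $P$ such that $\pi_*\circ J=j\circ\pi_*$ and the action map $(P\times H,J\times i_H)\to(P,J)$ is almost holomorphic (its differential intertwines the almost complex structures). It is $G$-invariant if $J$ commutes with the differential of the action on $P$ of every $g\in G$. It is integrable if its Nijenhuis tensor $N_J(X,Y)=[X,Y]+J[X,JY]+J[JX,Y]-[JX,JY]$ vanishes. *)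

theory Defs
  imports "HOL-Analysis.Analysis" "HOL-Algebra.Coset"
begin

section \<open>The upper half plane and the action of PSL(2,R)\<close>

definition upper_half_plane :: "complex set" where
  "upper_half_plane = {z. Im z > 0}"

definition SL2R :: "(real ^ 2 ^ 2) monoid" where
  "SL2R = \<lparr>carrier = {A. det A = 1}, mult = (**), one = mat 1\<rparr>"

definition PSL2R :: "(real ^ 2 ^ 2) set monoid" where
  "PSL2R = SL2R Mod {mat 1, - mat 1}"

definition SL2_act :: "real ^ 2 ^ 2 \<Rightarrow> complex \<Rightarrow> complex" where
  "SL2_act A = moebius (of_real (A $ 1 $ 1)) (of_real (A $ 1 $ 2))
                       (of_real (A $ 2 $ 1)) (of_real (A $ 2 $ 2))"

text \<open>An element of \<^const>\<open>PSL2R\<close> is a coset \<open>{A, - A}\<close>, on which \<^const>\<open>SL2_act\<close> is constant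
  (lemma \<open>PSL2_act_coset\<close> below).\<close>

definition PSL2_act :: "(real ^ 2 ^ 2) set \<Rightarrow> complex \<Rightarrow> complex" where
  "PSL2_act g = the_elem (SL2_act ` g)"

lemma SL2_act_uminus: "SL2_act (- A) = SL2_act A"
proof
  fix z
  have *: "(- a * z + - b) / (- c * z + - d) = (a * z + b) / (c * z + d)" for a b c d :: complex
    by (metis minus_add_distrib minus_divide_divide mult_minus_left)
  show "SL2_act (- A) z = SL2_act A z"
    using * by (simp add: SL2_act_def moebius_def)
qed

lemma carrier_PSL2R: "carrier PSL2R = (\<lambda>A. {A, - A}) ` {A. det A = 1}"
proof -
  have "(- mat 1) ** A = - A" for A :: "real ^ 2 ^ 2"
    using matrix_mul_lid[of A]
    by (simp add: matrix_matrix_mult_def vec_eq_iff sum_negf)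
  then show ?thesis
    by (auto simp: PSL2R_def FactGroup_def RCOSETS_def r_coset_def SL2R_def)
qed

lemma PSL2_act_coset:
  assumes "g \<in> carrier PSL2R" and "A \<in> g"
  shows "PSL2_act g = SL2_act A"
proof -
  have "SL2_act ` g = {SL2_act A}"
    using assms by (auto simp: carrier_PSL2R SL2_act_uminus)
  then show ?thesis by (simp add: PSL2_act_def)
qed

section \<open>The reduced frame bundle\<close>

text \<open>The tangent space of the half plane at each point is identified with the complex numbers,
  as usual for an open subset of a vector space; \<open>j\<close> is multiplication by \<open>\<i>\<close>.\<close>

type_synonym frame = "complex \<times> (complex \<Rightarrow> complex)"

definition j_std :: "complex \<Rightarrow> complex \<Rightarrow> complex" where
  "j_std x v = \<i> * v"

definition frame_bundle :: "frame set" where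
  "frame_bundle = {(x, \<phi>). x \<in> upper_half_plane \<and> linear \<phi> \<and> bij \<phi> \<and>
                            (\<forall>v. \<phi> (\<i> * v) = j_std x (\<phi> v))}"

definition bundle_proj :: "frame \<Rightarrow> complex" where
  "bundle_proj = (\<lambda>(x, \<phi>). x)"

definition left_act :: "(real ^ 2 ^ 2) set \<Rightarrow> frame \<Rightarrow> frame" where
  "left_act g = (\<lambda>(x, \<phi>). (PSL2_act g x, frechet_derivative (PSL2_act g) (at x) \<circ> \<phi>))"

definition right_act :: "frame \<Rightarrow> complex \<Rightarrow> frame" where
  "right_act = (\<lambda>(x, \<phi>) h. (x, \<lambda>v. \<phi> (h * v)))"

text \<open>The manifold structure of the frame bundle is given by the global chart
  \<open>(x, \<phi>) \<mapsto> (x, \<phi> 1)\<close>, whose image \<open>frame_coords\<close> is an open subset of \<open>\<complex>\<^sup>2\<close>.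
  All differential-geometric objects on the bundle are expressed in this chart: points are
  elements of \<open>frame_coords\<close> and tangent vectors are arbitrary elements of \<open>\<complex>\<^sup>2\<close>.\<close>

definition frame_chart :: "frame \<Rightarrow> complex \<times> complex" where
  "frame_chart = (\<lambda>(x, \<phi>). (x, \<phi> 1))"

definition frame_of :: "complex \<times> complex \<Rightarrow> frame" where
  "frame_of = (\<lambda>(x, w). (x, \<lambda>v. w * v))"

definition frame_coords :: "(complex \<times> complex) set" where
  "frame_coords = upper_half_plane \<times> (- {0})"

lemma frame_chart_frame_of: "frame_chart (frame_of p) = p"
  by (simp add: frame_chart_def frame_of_def case_prod_unfold)

lemma frame_of_frame_chart:
  assumes "q \<in> frame_bundle"
  shows "frame_of (frame_chart q) = q"
proof -
  obtain x \<phi> where q: "q = (x, \<phi>)" and lin: "linear \<phi>"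
    and ci: "\<And>v. \<phi> (\<i> * v) = \<i> * \<phi> v"
    using assms by (auto simp: frame_bundle_def j_std_def)
  have "\<phi> 1 * v = \<phi> v" for v
  proof -
    have "v = Re v *\<^sub>R 1 + Im v *\<^sub>R (\<i> * 1)"
      by (simp add: complex_eq_iff)
    then have "\<phi> v = Re v *\<^sub>R \<phi> 1 + Im v *\<^sub>R (\<i> * \<phi> 1)"
      by (metis ci lin linear_add linear_scale)
    then show ?thesis by (simp add: complex_eq_iff algebra_simps)
  qed
  then show ?thesis by (simp add: q frame_of_def frame_chart_def fun_eq_iff)
qed

lemma bij_betw_frame_of: "bij_betw frame_of frame_coords frame_bundle"
proof (rule bij_betw_byWitness[where f' = frame_chart])
  have "bij ((*) w)" if "w \<noteq> 0" for w :: complex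
    using that by (intro o_bij[where g = "\<lambda>v. v / w"]) auto
  then show "frame_of ` frame_coords \<subseteq> frame_bundle"
    by (auto simp: frame_of_def frame_coords_def frame_bundle_def j_std_def
        intro!: bounded_linear.linear bounded_linear_mult_right)
  show "frame_chart ` frame_bundle \<subseteq> frame_coords"
  proof
    fix p assume "p \<in> frame_chart ` frame_bundle"
    then obtain q where q: "q \<in> frame_bundle" "p = frame_chart q" by blast
    obtain x \<phi> where "q = (x, \<phi>)" by fastforce
    with q have p: "p = (x, \<phi> 1)" and x: "x \<in> upper_half_plane"
      and \<phi>: "linear \<phi>" "bij \<phi>"
      by (simp_all add: frame_chart_def frame_bundle_def)
    from \<phi> have "\<phi> 1 \<noteq> 0"
      by (metis bij_is_inj inj_eq linear_0 zero_neq_one)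
    then show "p \<in> frame_coords" by (simp add: p x frame_coords_def)
  qed
qed (auto simp: frame_chart_frame_of frame_of_frame_chart)

definition proj_coords :: "complex \<times> complex \<Rightarrow> complex" where
  "proj_coords p = bundle_proj (frame_of p)"

definition left_coords :: "(real ^ 2 ^ 2) set \<Rightarrow> complex \<times> complex \<Rightarrow> complex \<times> complex" where
  "left_coords g p = frame_chart (left_act g (frame_of p))"

definition right_coords :: "(complex \<times> complex) \<times> complex \<Rightarrow> complex \<times> complex" where
  "right_coords = (\<lambda>(p, h). frame_chart (right_act (frame_of p) h))"

section \<open>Complexions\<close>

primrec Ck_on ::
    "nat \<Rightarrow> ('a::real_normed_vector \<Rightarrow> 'b::real_normed_vector) \<Rightarrow> 'a set \<Rightarrow> bool" where
  "Ck_on 0 f S \<longleftrightarrow> continuous_on S f"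
| "Ck_on (Suc k) f S \<longleftrightarrow> (\<forall>x\<in>S. f differentiable at x) \<and>
     (\<forall>v. Ck_on k (\<lambda>x. frechet_derivative f (at x) v) S)"

text \<open>Adequate for open subsets of finite-dimensional spaces, the only case used below.\<close>

definition smooth_on ::
    "('a::real_normed_vector \<Rightarrow> 'b::real_normed_vector) \<Rightarrow> 'a set \<Rightarrow> bool" where
  "smooth_on f S \<longleftrightarrow> (\<forall>k. Ck_on k f S)"

type_synonym 'a vector_field = "'a \<Rightarrow> 'a"
type_synonym 'a endo_field = "'a \<Rightarrow> 'a \<Rightarrow> 'a"

text \<open>On an open set \<open>S\<close>. The value of \<open>J\<close> at points outside \<open>S\<close> carries no information;
  membership in \<open>extensional\<close> fixes it, so that equality of such \<open>J\<close> is equality on \<open>S\<close>.\<close>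

definition almost_complex_structure ::
    "'a::real_normed_vector set \<Rightarrow> 'a endo_field \<Rightarrow> bool" where
  "almost_complex_structure S J \<longleftrightarrow>
     J \<in> extensional S \<and>
     (\<forall>p\<in>S. linear (J p) \<and> (\<forall>v. J p (J p v) = - v)) \<and>
     (\<forall>v. smooth_on (\<lambda>p. J p v) S)"

definition complexion :: "(complex \<times> complex) endo_field \<Rightarrow> bool" where
  "complexion J \<longleftrightarrow>
     almost_complex_structure frame_coords J \<and>
     (\<forall>p\<in>frame_coords. \<forall>v.
        frechet_derivative proj_coords (at p) (J p v) =
        j_std (proj_coords p) (frechet_derivative proj_coords (at p) v)) \<and>
     (\<forall>p\<in>frame_coords. \<forall>h\<in>- {0}. \<forall>v c.
        frechet_derivative right_coords (at (p, h)) (J p v, \<i> * c) =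
        J (right_coords (p, h)) (frechet_derivative right_coords (at (p, h)) (v, c)))"

definition G_invariant :: "(complex \<times> complex) endo_field \<Rightarrow> bool" where
  "G_invariant J \<longleftrightarrow>
     (\<forall>g\<in>carrier PSL2R. \<forall>p\<in>frame_coords. \<forall>v.
        frechet_derivative (left_coords g) (at p) (J p v) =
        J (left_coords g p) (frechet_derivative (left_coords g) (at p) v))"

definition lie_bracket ::
    "'a::real_normed_vector vector_field \<Rightarrow> 'a vector_field \<Rightarrow> 'a vector_field" where
  "lie_bracket X Y p = frechet_derivative Y (at p) (X p) - frechet_derivative X (at p) (Y p)"

definition nijenhuis ::
    "'a::real_normed_vector endo_field \<Rightarrow> 'a vector_field \<Rightarrow> 'a vector_field \<Rightarrow> 'a vector_field" where
  "nijenhuis J X Y p =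
     lie_bracket X Y p + J p (lie_bracket X (\<lambda>q. J q (Y q)) p)
     + J p (lie_bracket (\<lambda>q. J q (X q)) Y p)
     - lie_bracket (\<lambda>q. J q (X q)) (\<lambda>q. J q (Y q)) p"

definition integrable_acs :: "'a::real_normed_vector set \<Rightarrow> 'a endo_field \<Rightarrow> bool" where
  "integrable_acs S J \<longleftrightarrow>
     (\<forall>X Y. smooth_on X S \<longrightarrow> smooth_on Y S \<longrightarrow> (\<forall>p\<in>S. nijenhuis J X Y p = 0))"

end

theory Submission
  imports Defs
begin

text \<open>
  In the chart \<open>(x, \<phi>) \<mapsto> (x, \<phi> 1)\<close> the bundle is an open subset of \<open>\<complex>\<^sup>2\<close>, and the unique
  structure is multiplication by \<open>\<i>\<close>. It is a complexion and it is invariant because the projection,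
  the right action \<open>((x, w), h) \<mapsto> (x, w h)\<close> and the left action \<open>(x, w) \<mapsto> (g x, g'(x) w)\<close> are
  holomorphic; it is integrable because its coefficients are constant
  (\<open>mult_i_field_complexion\<close>, \<open>mult_i_field_G_invariant\<close>, \<open>mult_i_field_integrable\<close>).

  For uniqueness, compatibility with the projection and with the fibre direction of the right
  action leave only one freedom: a complexion has the form
  \<open>J (u, s) = (\<i> u, \<i> s + A u)\<close>, where the real-linear map \<open>A\<close> depends on the point \<open>(x, w)\<close>
  (\<open>complexion_shape\<close>). Equivariance under \<open>h = - 1\<close> gives \<open>A\<close> the opposite sign at
  \<open>(x, - w)\<close>. The half-turn \<open>g\<close> about \<open>x\<close> has \<open>g x = x\<close> and \<open>g'(x) = - 1\<close>, so it also sends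
  \<open>(x, w)\<close> to \<open>(x, - w)\<close>, but it reverses \<open>u\<close> as well, so that invariance gives \<open>A\<close> the same
  value at both points. Hence \<open>A = 0\<close> (\<open>invariant_complexion_unique\<close>).\<close>

section \<open>The chart domain and the maps in coordinates\<close>

lemma frame_coords_iff: "p \<in> frame_coords \<longleftrightarrow> Im (fst p) > 0 \<and> snd p \<noteq> 0"
  by (cases p) (simp add: frame_coords_def upper_half_plane_def)

lemma open_frame_coords: "open frame_coords"
  unfolding frame_coords_def upper_half_plane_def
  by (intro open_Times open_halfspace_Im_gt) (simp add: open_Compl)

lemma has_derivative_proj_coords: "(proj_coords has_derivative fst) (at p)"
proof -
  have "proj_coords = fst"
    by (auto simp: proj_coords_def bundle_proj_def frame_of_def)
  then show ?thesis
    by (simp add: has_derivative_fst[OF has_derivative_ident])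
qed

lemma right_coords_eq: "right_coords ((x, w), h) = (x, w * h)"
  by (simp add: right_coords_def frame_chart_def right_act_def frame_of_def)

lemma has_derivative_right_coords:
  "(right_coords has_derivative (\<lambda>(v, c). (fst v, w * c + snd v * h))) (at ((x, w), h))"
proof -
  have "right_coords = (\<lambda>q. (fst (fst q), snd (fst q) * snd q))"
    by (auto simp: right_coords_eq)
  moreover have "((\<lambda>q. (fst (fst q), snd (fst q) * snd q)) has_derivative
      (\<lambda>(v, c). (fst v, w * c + snd v * h))) (at ((x, w), h))"
    by (auto intro!: derivative_eq_intros simp: case_prod_unfold)
  ultimately show ?thesis by simp
qed

section \<open>Moebius transformations on the half plane and its frames\<close>

text \<open>A real zero \<open>- d / c\<close> of the denominator is not in the half plane, and \<open>c = d = 0\<close> is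
  impossible for an invertible matrix.\<close>

lemma real_linear_denominator_nonzero:
  fixes c d :: real
  assumes "a * d - b * c = 1" and "Im x > 0"
  shows "of_real c * x + of_real d \<noteq> 0"
proof
  assume eq: "of_real c * x + of_real d = 0"
  then have "Im (of_real c * x + of_real d) = 0" by simp
  then have "c * Im x = 0" by simp
  with assms have "c = 0" by simp
  with eq have "d = 0" by simp
  with \<open>c = 0\<close> assms show False by simp
qed

lemma Im_moebius_pos:
  fixes a b c d :: real
  assumes det: "a * d - b * c = 1" and x: "Im x > 0"
  shows "Im (moebius (of_real a) (of_real b) (of_real c) (of_real d) x) > 0"
proof -
  let ?D = "of_real c * x + of_real d :: complex"
  have "?D \<noteq> 0" using real_linear_denominator_nonzero[OF assms] .
  then have pos: "(cmod ?D)\<^sup>2 > 0" by simp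
  have "Im ((of_real a * x + of_real b) / ?D) = (a * d - b * c) * Im x / (cmod ?D)\<^sup>2"
    by (subst complex_div_cnj) (simp add: algebra_simps flip: of_real_power)
  with det x pos show ?thesis by (simp add: moebius_def)
qed

lemma has_field_derivative_moebius:
  fixes x :: complex
  assumes "c * x + d \<noteq> 0" and "a * d - b * c = 1"
  shows "(moebius a b c d has_field_derivative 1 / (c * x + d)\<^sup>2) (at x)"
proof -
  have "((\<lambda>z. (a * z + b) / (c * z + d)) has_field_derivative
          (a * (c * x + d) - (a * x + b) * c) / ((c * x + d) * (c * x + d))) (at x)"
    using assms(1) by (auto intro!: derivative_eq_intros)
  moreover have "a * (c * x + d) - (a * x + b) * c = 1"
    using assms(2) by (simp add: algebra_simps)
  ultimately show ?thesis
    by (simp add: moebius_def[abs_def] power2_eq_square)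
qed

context
  fixes g :: "(real ^ 2 ^ 2) set" and A :: "real ^ 2 ^ 2" and c d :: complex
  assumes g: "g \<in> carrier PSL2R" and A: "A \<in> g"
  defines "c \<equiv> of_real (A $ 2 $ 1)" and "d \<equiv> of_real (A $ 2 $ 2)"
begin

lemma det_entries: "A $ 1 $ 1 * A $ 2 $ 2 - A $ 1 $ 2 * A $ 2 $ 1 = 1"
proof -
  from g A have "det A = 1"
    by (auto simp: carrier_PSL2R det_2)
  then show ?thesis by (simp add: det_2)
qed

lemma denominator_nonzero: "Im x > 0 \<Longrightarrow> c * x + d \<noteq> 0"
  unfolding c_def d_def by (rule real_linear_denominator_nonzero[OF det_entries])

lemma left_coords_eq:
  assumes "Im x > 0"
  shows "left_coords g (x, w) = (SL2_act A x, w / (c * x + d)\<^sup>2)"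
proof -
  have "of_real (A $ 1 $ 1) * of_real (A $ 2 $ 2) - of_real (A $ 1 $ 2) * of_real (A $ 2 $ 1)
          = (1 :: complex)"
    using det_entries by (metis of_real_1 of_real_diff of_real_mult)
  from has_field_derivative_moebius[OF denominator_nonzero[OF assms, unfolded c_def d_def] this]
  have "(SL2_act A has_field_derivative 1 / (c * x + d)\<^sup>2) (at x)"
    by (simp add: SL2_act_def c_def d_def)
  then have "frechet_derivative (SL2_act A) (at x) = (*) (1 / (c * x + d)\<^sup>2)"
    unfolding has_field_derivative_def by (rule frechet_derivative_at[symmetric])
  then show ?thesis
    by (simp add: left_coords_def frame_chart_def left_act_def frame_of_def PSL2_act_coset[OF g A])
qed

lemma left_coords_in_frame_coords:
  assumes "p \<in> frame_coords"
  shows "left_coords g p \<in> frame_coords"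
proof (cases p)
  case (Pair x w)
  with assms have x: "Im x > 0" and w: "w \<noteq> 0" by (simp_all add: frame_coords_iff)
  show ?thesis
    using left_coords_eq[OF x] denominator_nonzero[OF x] w Im_moebius_pos[OF det_entries x]
    by (simp add: Pair frame_coords_iff SL2_act_def)
qed

lemma has_derivative_left_coords:
  assumes x: "Im x > 0" and w: "w \<noteq> 0"
  shows "(left_coords g has_derivative
           (\<lambda>(u, s). (u / (c * x + d)\<^sup>2, s / (c * x + d)\<^sup>2 - 2 * c * w * u / (c * x + d) ^ 3)))
         (at (x, w))"
proof -
  let ?D = "c * x + d"
  note D = denominator_nonzero[OF x]
  have det: "of_real (A $ 1 $ 1) * d - of_real (A $ 1 $ 2) * c = 1"
    using det_entries unfolding c_def d_def by (metis of_real_1 of_real_diff of_real_mult)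
  have "(*) (1 / ?D\<^sup>2) = (\<lambda>u. u / ?D\<^sup>2)" by auto
  then have "(SL2_act A has_derivative (\<lambda>u. u / ?D\<^sup>2)) (at x)"
    using has_field_derivative_moebius[OF D det]
    by (simp add: has_field_derivative_def SL2_act_def c_def d_def)
  then have 1: "((\<lambda>p. SL2_act A (fst p)) has_derivative (\<lambda>v. fst v / ?D\<^sup>2)) (at (x, w))"
    using has_derivative_compose[OF has_derivative_fst[OF has_derivative_ident], of "SL2_act A" _ "(x, w)"]
    by simp
  have "((\<lambda>z. 1 / (c * z + d)\<^sup>2) has_field_derivative - (2 * c * ?D) / (?D\<^sup>2 * ?D\<^sup>2)) (at x)"
    using D by (auto intro!: derivative_eq_intros simp: mult_ac)
  moreover have "- (2 * c * E) / (E\<^sup>2 * E\<^sup>2) = - 2 * c / E ^ 3" if "E \<noteq> 0" for E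
    using that by (simp add: field_simps power2_eq_square power3_eq_cube)
  ultimately have "((\<lambda>z. 1 / (c * z + d)\<^sup>2) has_field_derivative - 2 * c / ?D ^ 3) (at x)"
    using D by simp
  then have "((\<lambda>z. 1 / (c * z + d)\<^sup>2) has_derivative (\<lambda>u. - 2 * c / ?D ^ 3 * u)) (at x)"
    by (rule has_field_derivative_imp_has_derivative)
  then have "((\<lambda>p. 1 / (c * fst p + d)\<^sup>2) has_derivative (\<lambda>v. - 2 * c / ?D ^ 3 * fst v)) (at (x, w))"
    using has_derivative_compose[OF has_derivative_fst[OF has_derivative_ident],
        of "\<lambda>z. 1 / (c * z + d)\<^sup>2" _ "(x, w)"] by simp
  from has_derivative_mult[OF has_derivative_snd[OF has_derivative_ident] this]
  have 2: "((\<lambda>p. snd p / (c * fst p + d)\<^sup>2) has_derivative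
          (\<lambda>v. snd v / ?D\<^sup>2 - 2 * c * w * fst v / ?D ^ 3)) (at (x, w))"
    by (simp add: algebra_simps)
  have "((\<lambda>p. (SL2_act A (fst p), snd p / (c * fst p + d)\<^sup>2)) has_derivative
          (\<lambda>v. (fst v / ?D\<^sup>2, snd v / ?D\<^sup>2 - 2 * c * w * fst v / ?D ^ 3))) (at (x, w))"
    by (rule has_derivative_Pair[OF 1 2])
  then have "(left_coords g has_derivative
          (\<lambda>v. (fst v / ?D\<^sup>2, snd v / ?D\<^sup>2 - 2 * c * w * fst v / ?D ^ 3))) (at (x, w))"
    by (rule has_derivative_transform_within_open[OF _ open_frame_coords])
       (use x w in \<open>auto simp: frame_coords_iff left_coords_eq\<close>)
  then show ?thesis by (simp add: case_prod_unfold)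
qed

end

text \<open>The half-turn of the hyperbolic plane about \<open>x = p + \<i> q\<close> is given by the matrix with rows
  \<open>(p, - p\<^sup>2 - q\<^sup>2) / q\<close> and \<open>(1, - p) / q\<close>. Its denominator takes the value \<open>\<i>\<close> at \<open>x\<close>, so its
  derivative there is \<open>1 / \<i>\<^sup>2 = - 1\<close>. The last component of its differential on frames involves
  the second derivative at \<open>x\<close>.\<close>

lemma half_turn_frames:
  assumes x: "Im x > 0" and w: "w \<noteq> 0"
  obtains g k where "g \<in> carrier PSL2R"
    and "left_coords g (x, w) = (x, - w)"
    and "(left_coords g has_derivative (\<lambda>(u, s). (- u, - s + k * u))) (at (x, w))"
proof -
  define p q where "p = Re x" and "q = Im x"
  define A :: "real ^ 2 ^ 2" where
    "A = vector [vector [p / q, - (p\<^sup>2 + q\<^sup>2) / q], vector [1 / q, - p / q]]"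
  have q: "q \<noteq> 0" using x by (simp add: q_def)
  have entries: "A $ 1 $ 1 = p / q" "A $ 1 $ 2 = - (p\<^sup>2 + q\<^sup>2) / q"
    "A $ 2 $ 1 = 1 / q" "A $ 2 $ 2 = - p / q"
    by (simp_all add: A_def)
  have "det A = 1"
    using q by (simp add: det_2 entries field_simps power2_eq_square)
  then have g: "{A, - A} \<in> carrier PSL2R" by (auto simp: carrier_PSL2R)
  have A: "A \<in> {A, - A}" by simp
  let ?c = "of_real (A $ 2 $ 1) :: complex" and ?d = "of_real (A $ 2 $ 2) :: complex"
  have D: "?c * x + ?d = \<i>"
    using q by (simp add: entries complex_eq_iff p_def q_def)
  have "of_real (p / q) * x + of_real (- (p\<^sup>2 + q\<^sup>2) / q) = \<i> * x"
    using q by (simp add: complex_eq_iff p_def q_def field_simps power2_eq_square)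
  then have fix_x: "SL2_act A x = x"
    using D by (simp add: SL2_act_def moebius_def entries)
  show ?thesis
  proof
    show "{A, - A} \<in> carrier PSL2R" by (rule g)
    show "left_coords {A, - A} (x, w) = (x, - w)"
      using left_coords_eq[OF g A x] by (simp add: D fix_x)
    have "(\<lambda>(u, s). (u / \<i>\<^sup>2, s / \<i>\<^sup>2 - 2 * ?c * w * u / \<i> ^ 3)) =
        (\<lambda>(u, s). (- u, - s + (- 2 * \<i> * ?c * w) * u))"
      by (auto simp: fun_eq_iff power3_eq_cube field_simps)
    then show "(left_coords {A, - A} has_derivative
        (\<lambda>(u, s). (- u, - s + (- 2 * \<i> * ?c * w) * u))) (at (x, w))"
      using has_derivative_left_coords[OF g A x w] by (simp only: D)
  qed
qed

section \<open>Uniqueness\<close>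

definition mult_i :: "complex \<times> complex \<Rightarrow> complex \<times> complex" where
  "mult_i v = (\<i> * fst v, \<i> * snd v)"

definition mult_i_field :: "(complex \<times> complex) endo_field" where
  "mult_i_field = restrict (\<lambda>p. mult_i) frame_coords"

lemma complexion_right_equivariant:
  assumes "complexion J" and "(x, w) \<in> frame_coords" and "h \<noteq> 0"
  shows "(fst (J (x, w) v), w * (\<i> * c) + snd (J (x, w) v) * h) =
         J (x, w * h) (fst v, w * c + snd v * h)"
proof -
  have "frechet_derivative right_coords (at ((x, w), h)) (J (x, w) v, \<i> * c) =
        J (right_coords ((x, w), h)) (frechet_derivative right_coords (at ((x, w), h)) (v, c))"
    using assms unfolding complexion_def by blast
  then show ?thesis
    by (simp add: frechet_derivative_at[OF has_derivative_right_coords, symmetric] right_coords_eq)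
qed

text \<open>The first component is prescribed by the projection. The vertical vectors are the
  velocities of the right action at the identity, where the structure must be that of \<open>\<complex>\<^sup>*\<close>; so
  only the vertical part of the image of a horizontal vector remains free.\<close>

lemma complexion_shape:
  assumes J: "complexion J" and p: "(x, w) \<in> frame_coords"
  shows "J (x, w) (u, s) = (\<i> * u, \<i> * s + snd (J (x, w) (u, 0)))"
proof -
  have lin: "linear (J (x, w))"
    using J p unfolding complexion_def almost_complex_structure_def by blast
  have w: "w \<noteq> 0" using p by (simp add: frame_coords_iff)
  have "frechet_derivative proj_coords (at (x, w)) (J (x, w) v) =
      j_std (proj_coords (x, w)) (frechet_derivative proj_coords (at (x, w)) v)" for v
    using J p unfolding complexion_def by blast
  then have fst_J: "fst (J (x, w) v) = \<i> * fst v" for v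
    by (simp add: frechet_derivative_at[OF has_derivative_proj_coords, symmetric] j_std_def)
  have vertical: "J (x, w) (0, s) = (0, \<i> * s)"
    using complexion_right_equivariant[OF J p, of 1 0 "s / w"] w linear_0[OF lin]
    by (simp add: zero_prod_def)
  have "J (x, w) (u, s) = J (x, w) (u, 0) + J (x, w) (0, s)"
    by (simp flip: linear_add[OF lin])
  then show ?thesis
    using fst_J[of "(u, 0)"] by (simp add: vertical prod_eq_iff)
qed

lemma invariant_complexion_unique:
  assumes J: "complexion J" and inv: "G_invariant J"
  shows "J = mult_i_field"
proof (rule extensionalityI[where A = frame_coords])
  show "J \<in> extensional frame_coords"
    using J unfolding complexion_def almost_complex_structure_def by blast
  show "mult_i_field \<in> extensional frame_coords" by (simp add: mult_i_field_def)
next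
  fix p assume pS: "p \<in> frame_coords"
  obtain x w where p: "p = (x, w)" by fastforce
  have xw: "(x, w) \<in> frame_coords" and x: "Im x > 0" and w: "w \<noteq> 0"
    using pS by (simp_all add: p frame_coords_iff)
  have neg: "(x, - w) \<in> frame_coords" using x w by (simp add: frame_coords_iff)
  obtain g k where g: "g \<in> carrier PSL2R"
    and gx: "left_coords g (x, w) = (x, - w)"
    and dg: "(left_coords g has_derivative (\<lambda>(u, s). (- u, - s + k * u))) (at (x, w))"
    by (rule half_turn_frames[OF x w])
  have "snd (J (x, w) (u, 0)) = 0" for u
  proof -
    define a where "a = snd (J (x, w) (u, 0))"
    have a: "J (x, w) (u, 0) = (\<i> * u, a)"
      using complexion_shape[OF J xw, of u 0] by (simp add: a_def)
    have "J (x, - w) (- u, 0) = - J (x, - w) (u, 0)"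
      using J neg linear_neg[of "J (x, - w)" "(u, 0)"]
      unfolding complexion_def almost_complex_structure_def by simp
    also have "J (x, - w) (u, 0) = (\<i> * u, - a)"
      using complexion_right_equivariant[OF J xw, of "- 1" "(u, 0)" 0] by (simp add: a)
    finally have J_neg: "J (x, - w) (- u, 0) = (- \<i> * u, a)" by simp
    have "frechet_derivative (left_coords g) (at (x, w)) (J (x, w) (u, 0)) =
        J (left_coords g (x, w)) (frechet_derivative (left_coords g) (at (x, w)) (u, 0))"
      using inv g xw unfolding G_invariant_def by blast
    \<comment> \<open>The vertical term \<open>k u\<close> is multiplied by \<open>\<i>\<close> on both sides, so it cancels and only
      \<open>- a = a\<close> is left.\<close>
    then have "(- (\<i> * u), - a + k * (\<i> * u)) = J (x, - w) (- u, k * u)"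
      by (simp add: frechet_derivative_at[OF dg, symmetric] gx a)
    also have "\<dots> = (- (\<i> * u), \<i> * (k * u) + a)"
      by (subst complexion_shape[OF J neg]) (simp add: J_neg)
    finally show ?thesis by (simp add: a_def algebra_simps)
  qed
  then have "J p v = mult_i v" for v
    using complexion_shape[OF J xw, of "fst v" "snd v"] by (simp add: p mult_i_def)
  with pS show "J p = mult_i_field p" by (simp add: mult_i_field_def fun_eq_iff)
qed

section \<open>Existence\<close>

lemma mult_i_field_apply: "p \<in> frame_coords \<Longrightarrow> mult_i_field p v = mult_i v"
  by (simp add: mult_i_field_def)

lemma bounded_linear_mult_i: "bounded_linear mult_i"
  unfolding mult_i_def[abs_def]
  by (intro bounded_linear_Pair bounded_linear_const_mult bounded_linear_fst bounded_linear_snd)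

text \<open>A field on the bundle is only given on the chart domain. The derivatives in the definition of
  smoothness are taken in the whole space, and openness makes the values elsewhere irrelevant.\<close>

lemma Ck_on_cong_open:
  assumes "open S"
  shows "(\<And>x. x \<in> S \<Longrightarrow> f x = g x) \<Longrightarrow> Ck_on k f S \<longleftrightarrow> Ck_on k g S"
proof (induction k arbitrary: f g)
  case 0
  then show ?case by (simp cong: continuous_on_cong)
next
  case (Suc k)
  have D: "(f has_derivative D) (at x) \<longleftrightarrow> (g has_derivative D) (at x)" if "x \<in> S" for D x
    using that assms Suc.prems has_derivative_transform_within_open by (metis (no_types, lifting))
  then have diff: "f differentiable at x \<longleftrightarrow> g differentiable at x" if "x \<in> S" for x
    using that by (simp add: differentiable_def)
  have "Ck_on k (\<lambda>x. frechet_derivative f (at x) v) S \<longleftrightarrow>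
      Ck_on k (\<lambda>x. frechet_derivative g (at x) v) S" for v
    by (rule Suc.IH) (simp add: frechet_derivative_def D)
  with diff show ?case by simp
qed

lemma Ck_on_const: "Ck_on k (\<lambda>x. a) S"
  by (induction k arbitrary: a) simp_all

lemma smooth_on_const_on_open:
  assumes "open S" and "\<And>x. x \<in> S \<Longrightarrow> f x = a"
  shows "smooth_on f S"
  unfolding smooth_on_def using Ck_on_cong_open[OF assms(1), of f "\<lambda>x. a"] assms(2)
  by (simp add: Ck_on_const)

lemma mult_i_field_complexion: "complexion mult_i_field"
proof -
  have "almost_complex_structure frame_coords mult_i_field"
    unfolding almost_complex_structure_def
  proof (intro conjI ballI allI)
    show "mult_i_field \<in> extensional frame_coords" by (simp add: mult_i_field_def)
    show "linear (mult_i_field p)" if "p \<in> frame_coords" for p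
      using that bounded_linear.linear[OF bounded_linear_mult_i] by (simp add: mult_i_field_def)
    show "mult_i_field p (mult_i_field p v) = - v" if "p \<in> frame_coords" for p v
      using that by (simp add: mult_i_field_apply mult_i_def prod_eq_iff)
    show "smooth_on (\<lambda>p. mult_i_field p v) frame_coords" for v
      by (rule smooth_on_const_on_open[OF open_frame_coords]) (rule mult_i_field_apply)
  qed
  moreover have "frechet_derivative proj_coords (at p) (mult_i_field p v) =
      j_std (proj_coords p) (frechet_derivative proj_coords (at p) v)"
    if "p \<in> frame_coords" for p v
    using that by (simp add: frechet_derivative_at[OF has_derivative_proj_coords, symmetric]
        j_std_def mult_i_field_apply mult_i_def)
  moreover have "frechet_derivative right_coords (at (p, h)) (mult_i_field p v, \<i> * c) =
      mult_i_field (right_coords (p, h)) (frechet_derivative right_coords (at (p, h)) (v, c))"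
    if p: "p \<in> frame_coords" and h: "h \<in> - {0}" for p h v c
  proof -
    obtain x w where xw: "p = (x, w)" by fastforce
    have "(x, w * h) \<in> frame_coords" using p h by (simp add: xw frame_coords_iff)
    then show ?thesis
      using p by (simp add: xw frechet_derivative_at[OF has_derivative_right_coords, symmetric]
          right_coords_eq mult_i_field_apply mult_i_def algebra_simps)
  qed
  ultimately show ?thesis unfolding complexion_def by blast
qed

lemma mult_i_field_G_invariant: "G_invariant mult_i_field"
  unfolding G_invariant_def
proof (intro ballI allI)
  fix g p v assume g: "g \<in> carrier PSL2R" and p: "p \<in> frame_coords"
  obtain A where A: "A \<in> g" using g by (auto simp: carrier_PSL2R)
  obtain x w where xw: "p = (x, w)" by fastforce
  have x: "Im x > 0" and w: "w \<noteq> 0" using p by (simp_all add: xw frame_coords_iff)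
  show "frechet_derivative (left_coords g) (at p) (mult_i_field p v) =
      mult_i_field (left_coords g p) (frechet_derivative (left_coords g) (at p) v)"
    unfolding mult_i_field_apply[OF p] mult_i_field_apply[OF left_coords_in_frame_coords[OF g A p]]
    unfolding xw frechet_derivative_at[OF has_derivative_left_coords[OF g A x w], symmetric]
    by (simp add: mult_i_def case_prod_unfold algebra_simps)
qed

text \<open>Since the coefficients are constant, \<open>\<i>\<close> passes through the derivative of a vector field.
  With \<open>a = DY(X)\<close>, \<open>b = DX(Y)\<close>, \<open>a' = DY(\<i> X)\<close> and \<open>b' = DX(\<i> Y)\<close>, the Nijenhuis tensor is
  \<open>(a - b) + \<i> (\<i> a - b') + \<i> (a' - \<i> b) - (\<i> a' - \<i> b') = 0\<close>.\<close>

lemma mult_i_field_integrable: "integrable_acs frame_coords mult_i_field"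
  unfolding integrable_acs_def
proof (intro allI impI ballI)
  fix X Y :: "(complex \<times> complex) vector_field" and p
  assume X: "smooth_on X frame_coords" and Y: "smooth_on Y frame_coords"
    and p: "p \<in> frame_coords"
  have D: "frechet_derivative (\<lambda>q. mult_i_field q (Z q)) (at p) =
      (\<lambda>v. mult_i (frechet_derivative Z (at p) v))" if "smooth_on Z frame_coords" for Z
  proof -
    have "Ck_on 1 Z frame_coords" using that unfolding smooth_on_def by blast
    with p have "(Z has_derivative frechet_derivative Z (at p)) (at p)"
      by (simp add: frechet_derivative_works)
    from bounded_linear.has_derivative[OF bounded_linear_mult_i this]
    have "((\<lambda>q. mult_i_field q (Z q)) has_derivative
        (\<lambda>v. mult_i (frechet_derivative Z (at p) v))) (at p)"
      by (rule has_derivative_transform_within_open[OF _ open_frame_coords p])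
         (simp add: mult_i_field_apply)
    then show ?thesis by (rule frechet_derivative_at[symmetric])
  qed
  show "nijenhuis mult_i_field X Y p = 0"
    unfolding nijenhuis_def lie_bracket_def D[OF X] D[OF Y] mult_i_field_apply[OF p]
    by (simp add: mult_i_def prod_eq_iff algebra_simps)
qed

theorem proposition6p1:
  shows "\<exists>!J. complexion J \<and> G_invariant J \<and> integrable_acs frame_coords J"
  using mult_i_field_complexion mult_i_field_G_invariant mult_i_field_integrable
    invariant_complexion_unique
  by blast

end
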